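(* Let $(L_k)_{k\ge 1}$ be a sequence of independent real random variables, each with the Laplace density $\frac12 e^{-|x|}$, $x\in\mathbb{R}$, and define the random variable $$L=\sum_{k=1}^{+\infty}\frac{L_k}{2\pi k}.$$ Then $L$ follows a logistic distribution, with density $$f_L(x)=\frac{\pi}{2}\,\mathrm{sech}^2(\pi x),\quad x\in\mathbb{R}.$$
   Context: $\mathrm{sech}(x)=1/\cosh(x)$. Densities are with respect to Lebesgue measure on $\mathbb{R}$. The series defining $L$ is understood as the almost sure limit of its partial sums. *)

theory Defs
  imports "HOL-Probability.Probability"
begin

definition sech :: "real \<Rightarrow> real"
  where "sech x = 1 / cosh x"

definition laplace_density :: "real \<Rightarrow> real"
  where "laplace_density x = exp (- \<bar>x\<bar>) / 2"

text \<open>The logistic family with location \<open>m\<close> and scale \<open>s > 0\<close>.\<close>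

definition logistic_density :: "real \<Rightarrow> real \<Rightarrow> real \<Rightarrow> real"
  where "logistic_density m s x =
    exp (- (x - m) / s) / (s * (1 + exp (- (x - m) / s))\<^sup>2)"

definition laplace_partial_sum :: "(nat \<Rightarrow> 'a \<Rightarrow> real) \<Rightarrow> nat \<Rightarrow> 'a \<Rightarrow> real"
  where "laplace_partial_sum X n \<omega> = (\<Sum>k=1..n. X k \<omega> / (2 * pi * real k))"

text \<open>A random variable \<open>L\<close> is the sum of the series when it is an almost sure limit of the
  partial sums; it is then determined up to a null set. Measurability of \<open>L\<close> is required
  explicitly because \<open>M\<close> need not be complete.\<close>

definition is_laplace_series :: "'a measure \<Rightarrow> (nat \<Rightarrow> 'a \<Rightarrow> real) \<Rightarrow> ('a \<Rightarrow> real) \<Rightarrow> bool"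
  where "is_laplace_series M X L \<longleftrightarrow>
    L \<in> borel_measurable M \<and> (AE \<omega> in M. (\<lambda>n. laplace_partial_sum X n \<omega>) \<longlonglongrightarrow> L \<omega>)"

end

theory Submission
  imports Defs
begin

text \<open>
  The characteristic function of the Laplace density is \<open>1 / (1 + t\<^sup>2)\<close>, so, with \<open>y = t / (2 pi)\<close>, the
  characteristic functions of the partial sums are the products of \<open>1 / (1 + y\<^sup>2 / k\<^sup>2)\<close>. By Euler's
  product for the sine and the reflection formula they tend to \<open>Gamma (1 + \<i> y) * Gamma (1 - \<i> y)\<close>
  (\<open>sin_product_limit_Gamma\<close>), and by dominated convergence this is the characteristic function of the
  series.

  The limit is recognised without inverting a Fourier transform. By Euler's integral,
  \<open>Gamma (1 + \<i> y)\<close> is the characteristic function at \<open>y\<close> of the logarithm of a standard exponential variable,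
  so the product belongs to \<open>(ln E\<^sub>1 - ln E\<^sub>2) / (2 pi)\<close> with independent standard exponential \<open>E\<^sub>1\<close> and
  \<open>E\<^sub>2\<close> (\<open>char_log_ratio\<close>). The event that this variable is at most \<open>a\<close> compares \<open>E\<^sub>1\<close> with a multiple of
  \<open>E\<^sub>2\<close>, and an elementary integral gives its probability \<open>1 / (1 + exp (- 2 pi a))\<close>
  (\<open>emeasure_log_ratio_atMost\<close>), the logistic distribution function with location \<open>0\<close> and scale
  \<open>1 / (2 pi)\<close>. Levy's uniqueness theorem identifies the two laws, and the density is the
  derivative of the distribution function.

  That the series converges almost surely is shown by summation by parts. Exponential moments give a
  fourth moment of order \<open>n\<^sup>2\<close> for the unweighted sums of \<open>n\<close> variables
  (\<open>laplace_sum_fourth_moment\<close>), hence almost surely these sums are \<open>O(n powr (7/8))\<close>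
  (\<open>laplace_sum_growth\<close>), and a sequence with partial sums of this order has a convergent series after division by
  the index (\<open>convergent_sum_div_index\<close>).
\<close>

section \<open>The Laplace law\<close>

lemma has_bochner_integral_exp_half_line:
  fixes w :: complex
  assumes "Re w > 0"
  shows "has_bochner_integral lborel (\<lambda>x. indicator {0..} x *\<^sub>R exp (- (w * of_real x))) (1 / w)"
proof -
  have w: "w \<noteq> 0" using assms by auto
  have int0: "integrable lborel (\<lambda>x. exponential_density (Re w) x)"
  proof (rule integrableI_nonneg)
    show "(\<integral>\<^sup>+x. ennreal (exponential_density (Re w) x) \<partial>lborel) < \<infinity>"
      using nn_integral_erlang_ith_moment[OF assms, of 0 0] by simp
  qed (use exponential_density_nonneg[OF assms] in auto)
  have int: "integrable lborel (\<lambda>x. indicator {0..} x *\<^sub>R exp (- (w * of_real x)))"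
    by (rule Bochner_Integration.integrable_bound[OF integrable_divide[OF int0, of "Re w"]])
       (use assms in \<open>auto simp: exponential_density_def indicator_def field_simps\<close>)
  have sint: "set_integrable lborel (einterval 0 \<infinity>) (\<lambda>x. exp (- (w * of_real x)))"
  proof (rule set_integrable_subset)
    show "set_integrable lborel {0..} (\<lambda>x. exp (- (w * of_real x)))"
      using int by (simp add: set_integrable_def)
  qed (auto simp: einterval_def)
  have "((\<lambda>x. exp (- (Re w * x))) \<longlongrightarrow> 0) at_top"
    using assms by real_asymp
  hence "((\<lambda>x. exp (- (w * of_real x))) \<longlongrightarrow> 0) at_top"
    by (subst tendsto_norm_zero_iff[symmetric]) simp
  hence lim: "((\<lambda>x. - exp (- (w * of_real x)) / w) \<longlongrightarrow> 0) at_top"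
    using tendsto_mult_right_zero[of _ _ "- 1 / w"] by fastforce
  have "(LBINT x=0..\<infinity>. exp (- (w * of_real x))) = 0 - (- (1 / w))"
  proof (rule interval_integral_FTC_integrable[where F="\<lambda>x. - exp (- (w * of_real x)) / w"])
    show "((\<lambda>x. - exp (- (w * of_real x)) / w) has_vector_derivative exp (- (w * of_real x))) (at x)" for x
    proof -
      have "((\<lambda>z. - exp (- (w * z)) / w) has_field_derivative exp (- (w * of_real x))) (at (of_real x))"
        using w by (auto intro!: derivative_eq_intros)
      from has_vector_derivative_real_field[OF this] show ?thesis by simp
    qed
    show "(((\<lambda>x. - exp (- (w * of_real x)) / w) \<circ> real_of_ereal) \<longlongrightarrow> (- (1/w))) (at_right 0)"
    proof -
      have "((\<lambda>x. - exp (- (w * complex_of_real x)) / w) \<longlongrightarrow> (- exp (- (w * complex_of_real 0)) / w)) (at_right 0)"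
        by (intro tendsto_intros w)
      thus ?thesis
        unfolding zero_ereal_def ereal_tendsto_simps by simp
    qed
    show "(((\<lambda>x. - exp (- (w * of_real x)) / w) \<circ> real_of_ereal) \<longlongrightarrow> 0) (at_left \<infinity>)"
      unfolding ereal_tendsto_simps using lim .
    show "isCont (\<lambda>x. exp (- (w * complex_of_real x))) x" for x
      by (intro continuous_intros)
  qed (use sint in simp_all)
  hence val: "(LBINT x:{0<..}. exp (- (w * of_real x))) = 1 / w"
    by (simp add: interval_lebesgue_integral_0_infty)
  have "integral\<^sup>L lborel (\<lambda>x. indicator {0..} x *\<^sub>R exp (- (w * of_real x)))
      = (LBINT x:{0<..}. exp (- (w * of_real x)))"
    unfolding set_lebesgue_integral_def
    by (rule integral_cong_AE; use AE_lborel_singleton[of 0] in \<open>auto simp: indicator_def elim!: eventually_mono\<close>)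
  with val int show ?thesis
    by (simp add: has_bochner_integral_iff)
qed

text \<open>The whole strip of complex exponents serves at once the characteristic function (imaginary \<open>z\<close>) and the exponential moments (real \<open>z\<close>).\<close>

lemma has_bochner_integral_laplace_exp:
  fixes z :: complex
  assumes "\<bar>Re z\<bar> < 1"
  shows "has_bochner_integral lborel (\<lambda>x. laplace_density x *\<^sub>R exp (z * of_real x)) (1 / (1 - z\<^sup>2))"
proof -
  have "has_bochner_integral lborel (\<lambda>x. indicator {0..} (0 + (-1) * x) *\<^sub>R exp (- ((1 + z) * of_real (0 + (-1) * x))))
     (((1 / (1 + z))) /\<^sub>R \<bar>-1\<bar>)"
    by (subst lborel_has_bochner_integral_real_affine_iff[symmetric])
       (use has_bochner_integral_exp_half_line[of "1 + z"] assms in auto)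
  hence neg: "has_bochner_integral lborel (\<lambda>x. indicator {..0} x *\<^sub>R exp ((1 + z) * of_real x)) (1 / (1 + z))"
    by (simp add: indicator_def)
  have pos: "has_bochner_integral lborel (\<lambda>x. indicator {0..} x *\<^sub>R exp (- ((1 - z) * of_real x))) (1 / (1 - z))"
    by (rule has_bochner_integral_exp_half_line) (use assms in auto)
  have ne: "1 + z \<noteq> 0" "1 - z \<noteq> 0"
    using assms by (auto simp: complex_eq_iff)
  have "has_bochner_integral lborel
    (\<lambda>x. (indicator {0..} x *\<^sub>R exp (- ((1 - z) * of_real x)) + indicator {..0} x *\<^sub>R exp ((1 + z) * of_real x)) / 2)
    ((1 / (1 - z) + 1 / (1 + z)) / 2)"
    by (intro has_bochner_integral_divide has_bochner_integral_add pos neg)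
  also have "((1 / (1 - z) + 1 / (1 + z)) / 2) = 1 / (1 - z\<^sup>2)"
    using ne by (simp add: divide_simps square_eq_1_iff power2_eq_square) (auto simp: algebra_simps add_eq_0_iff square_eq_1_iff)
  finally show ?thesis
  proof (rule has_bochner_integral_cong_AE[THEN iffD1, rotated -1])
    show "AE x in lborel. (indicator {0..} x *\<^sub>R exp (- ((1 - z) * of_real x)) + indicator {..0} x *\<^sub>R exp ((1 + z) * of_real x)) / 2
        = laplace_density x *\<^sub>R exp (z * complex_of_real x)"
      using AE_lborel_singleton[of 0]
    proof eventually_elim
      case (elim x)
      thus ?case
        by (auto simp: laplace_density_def indicator_def scaleR_conv_of_real exp_of_real[symmetric] abs_if algebra_simps
             simp flip: exp_add)
    qed
  qed (auto simp: laplace_density_def)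
qed

lemma laplace_density_nonneg: "laplace_density x \<ge> 0"
  by (simp add: laplace_density_def)

lemma borel_measurable_laplace_density [measurable]: "laplace_density \<in> borel_measurable borel"
  unfolding laplace_density_def by measurable

lemma char_laplace:
  assumes "distributed M lborel Y (\<lambda>x. ennreal (laplace_density x))"
  shows "char (distr M borel Y) t = 1 / (1 + of_real t ^ 2)"
proof -
  have [measurable]: "Y \<in> borel_measurable M"
    using distributed_measurable[OF assms] by simp
  have d: "distr M lborel Y = density lborel (\<lambda>x. ennreal (laplace_density x))"
    using distributed_distr_eq_density[OF assms] .
  have "char (distr M borel Y) t = integral\<^sup>L (distr M lborel Y) (\<lambda>x. iexp (t * x))"
    by (simp add: char_def integral_distr)
  also have "\<dots> = (\<integral>x. laplace_density x *\<^sub>R iexp (t * x) \<partial>lborel)"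
    unfolding d by (rule integral_density) (auto simp: laplace_density_nonneg)
  also have "\<dots> = 1 / (1 - (\<i> * of_real t)\<^sup>2)"
    using has_bochner_integral_laplace_exp[of "\<i> * of_real t"]
    by (simp add: has_bochner_integral_iff mult.assoc)
  finally show ?thesis by (simp add: power_mult_distrib)
qed

lemma laplace_exponential_moment:
  assumes "distributed M lborel Y (\<lambda>x. ennreal (laplace_density x))" "\<bar>s\<bar> < 1"
  shows "(\<integral>\<^sup>+\<omega>. ennreal (exp (s * Y \<omega>)) \<partial>M) = ennreal (1 / (1 - s\<^sup>2))"
proof -
  have "has_bochner_integral lborel (\<lambda>x. complex_of_real (laplace_density x * exp (s * x))) (of_real (1 / (1 - s\<^sup>2)))"
    using has_bochner_integral_laplace_exp[of "of_real s"] assms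
    by (simp add: scaleR_conv_of_real exp_of_real[symmetric])
  from has_bochner_integral_bounded_linear[OF bounded_linear_Re this]
  have h: "has_bochner_integral lborel (\<lambda>x. laplace_density x * exp (s * x)) (1 / (1 - s\<^sup>2))"
    by (simp only: Re_complex_of_real)
  have "(\<integral>\<^sup>+\<omega>. ennreal (exp (s * Y \<omega>)) \<partial>M) = (\<integral>\<^sup>+x. ennreal (laplace_density x) * ennreal (exp (s * x)) \<partial>lborel)"
    by (rule distributed_nn_integral[OF assms(1), symmetric]) auto
  also have "\<dots> = (\<integral>\<^sup>+x. ennreal (laplace_density x * exp (s * x)) \<partial>lborel)"
    by (simp add: ennreal_mult laplace_density_nonneg)
  also have "\<dots> = ennreal (1 / (1 - s\<^sup>2))"
    using h by (subst nn_integral_eq_integral) (auto simp: has_bochner_integral_iff laplace_density_nonneg)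
  finally show ?thesis .
qed

section \<open>Almost sure convergence of the series\<close>

lemma power4_le_exp:
  fixes x :: real
  shows "x ^ 4 \<le> 256 * (exp x + exp (- x))"
proof -
  have pos: "y ^ 4 \<le> 256 * exp y" if "y \<ge> 0" for y :: real
  proof -
    have "(y / 4) ^ 4 \<le> (1 + y / real 4) ^ 4"
      using that by (intro power_mono) auto
    also have "\<dots> \<le> exp y"
      using that by (intro exp_ge_one_plus_x_over_n_power_n) auto
    finally show ?thesis by (simp add: power_divide)
  qed
  show ?thesis
  proof (cases "x \<ge> 0")
    case True
    show ?thesis using pos[OF True] by (simp add: distrib_left add_increasing2)
  next
    case False
    have "x ^ 4 = (- x) ^ 4" by simp
    also have "\<dots> \<le> 256 * exp (- x)" using False by (intro pos) auto
    finally show ?thesis by (simp add: distrib_left add_increasing)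
  qed
qed

lemma (in prob_space) laplace_sum_exponential_moment:
  assumes indep: "indep_vars (\<lambda>_. borel) X {1..n}"
    and laplace: "\<And>k. k \<in> {1..n} \<Longrightarrow> distributed M lborel (X k) (\<lambda>x. ennreal (laplace_density x))"
    and s: "\<bar>s\<bar> < 1"
  shows "(\<integral>\<^sup>+\<omega>. ennreal (exp (s * (\<Sum>k=1..n. X k \<omega>))) \<partial>M) = ennreal ((1 / (1 - s\<^sup>2)) ^ n)"
proof -
  have s2: "s\<^sup>2 < 1" using s by (simp add: abs_square_less_1)
  have indep': "indep_vars (\<lambda>_. borel) (\<lambda>k \<omega>. ennreal (exp (s * X k \<omega>))) {1..n}"
    by (rule indep_vars_compose2[OF indep]) auto
  have "(\<integral>\<^sup>+\<omega>. ennreal (exp (s * (\<Sum>k=1..n. X k \<omega>))) \<partial>M)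
      = (\<integral>\<^sup>+\<omega>. (\<Prod>k=1..n. ennreal (exp (s * X k \<omega>))) \<partial>M)"
    by (simp add: sum_distrib_left exp_sum prod_ennreal)
  also have "\<dots> = (\<Prod>k=1..n. \<integral>\<^sup>+\<omega>. ennreal (exp (s * X k \<omega>)) \<partial>M)"
    by (intro indep_vars_nn_integral indep') auto
  also have "\<dots> = (\<Prod>k=1..n. ennreal (1 / (1 - s\<^sup>2)))"
    by (intro prod.cong laplace_exponential_moment laplace s) auto
  also have "\<dots> = ennreal ((1 / (1 - s\<^sup>2)) ^ n)"
    using s2 by (simp add: ennreal_power)
  finally show ?thesis .
qed

text \<open>An exponential moment avoids expanding the fourth power: at \<open>t = 1 / sqrt (2 n)\<close> the exponential
  moment \<open>(1 - t\<^sup>2) ^ (- n)\<close> of the sum is at most \<open>2\<close> by Bernoulli's inequality, and \<open>(t S) ^ 4\<close> is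
  dominated by a multiple of \<open>exp (t S) + exp (- t S)\<close>.\<close>

lemma (in prob_space) laplace_sum_fourth_moment:
  assumes indep: "indep_vars (\<lambda>_. borel) X {1..n}"
    and laplace: "\<And>k. k \<in> {1..n} \<Longrightarrow> distributed M lborel (X k) (\<lambda>x. ennreal (laplace_density x))"
  shows "(\<integral>\<^sup>+\<omega>. ennreal ((\<Sum>k=1..n. X k \<omega>) ^ 4) \<partial>M) \<le> ennreal (4096 * real n ^ 2)"
proof (cases "n = 0")
  case False
  have [measurable]: "X k \<in> borel_measurable M" if "k \<in> {1..n}" for k
    using distributed_measurable[OF laplace[OF that]] by simp
  \<comment> \<open>The sum has variance \<open>2 n\<close>, so this is the scale at which its exponential moment stays bounded.\<close>
  define t where "t = 1 / sqrt (2 * real n)"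
  have t: "t\<^sup>2 = 1 / (2 * real n)" "t \<noteq> 0" "\<bar>t\<bar> < 1"
    using False by (auto simp: t_def power_divide)
  have t4: "t ^ 4 = 1 / (4 * real n ^ 2)"
    using t(1) by (simp add: power4_eq_xxxx power2_eq_square)
  define C where "C = (1 / (1 - t\<^sup>2)) ^ n"
  have "1 / 2 \<le> (1 - t\<^sup>2) ^ n"
    using Bernoulli_inequality[of "- t\<^sup>2" n] False by (simp add: t(1) field_simps)
  hence C: "0 \<le> C" "C \<le> 2"
    by (auto simp: C_def power_one_over divide_simps)
  have E: "(\<integral>\<^sup>+\<omega>. ennreal (exp (s * (\<Sum>k=1..n. X k \<omega>))) \<partial>M) = ennreal C" if "s = t \<or> s = - t" for s
    using laplace_sum_exponential_moment[OF indep laplace, of s] that t by (auto simp: C_def)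
  have "(\<integral>\<^sup>+\<omega>. ennreal ((\<Sum>k=1..n. X k \<omega>) ^ 4) \<partial>M)
     \<le> (\<integral>\<^sup>+\<omega>. ennreal (1024 * real n ^ 2) * (ennreal (exp (t * (\<Sum>k=1..n. X k \<omega>)))
           + ennreal (exp ((- t) * (\<Sum>k=1..n. X k \<omega>)))) \<partial>M)"
  proof (intro nn_integral_mono)
    fix \<omega>
    define S where "S = (\<Sum>k=1..n. X k \<omega>)"
    have "S ^ 4 \<le> 1024 * real n ^ 2 * (exp (t * S) + exp (- t * S))"
      using power4_le_exp[of "t * S"] False unfolding power_mult_distrib t4 by (simp add: field_simps)
    thus "ennreal ((\<Sum>k=1..n. X k \<omega>) ^ 4) \<le> ennreal (1024 * real n ^ 2) * (ennreal (exp (t * (\<Sum>k=1..n. X k \<omega>)))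
           + ennreal (exp ((- t) * (\<Sum>k=1..n. X k \<omega>))))"
      unfolding S_def[symmetric] by (simp add: ennreal_leI flip: ennreal_plus ennreal_mult')
  qed
  also have "\<dots> = ennreal (1024 * real n ^ 2) * (ennreal C + ennreal C)"
    by (subst nn_integral_cmult, measurable, subst nn_integral_add, measurable) (simp only: E simp_thms)
  also have "\<dots> = ennreal (1024 * real n ^ 2 * (C + C))"
    using C by (simp flip: ennreal_plus ennreal_mult')
  also have "\<dots> \<le> ennreal (4096 * real n ^ 2)"
    using C by (intro ennreal_leI) (simp add: mult_right_mono)
  finally show ?thesis .
qed simp

text \<open>With the weights \<open>n powr (-7/2)\<close>, the expected fourth powers are of order \<open>n powr (-3/2)\<close> and so
  have a finite sum; the series of weighted fourth powers is therefore almost surely finite, and its sum bounds each term.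
  The exponent \<open>7/8\<close> only has to be smaller than \<open>1\<close> for the summation by parts that follows.\<close>

lemma (in prob_space) laplace_sum_growth:
  assumes indep: "indep_vars (\<lambda>_. borel) X {1..}"
    and laplace: "\<And>k. k \<ge> 1 \<Longrightarrow> distributed M lborel (X k) (\<lambda>x. ennreal (laplace_density x))"
  shows "AE \<omega> in M. \<exists>K. \<forall>n. \<bar>\<Sum>k=1..n. X k \<omega>\<bar> \<le> K * real n powr (7/8)"
proof -
  have [measurable]: "X k \<in> borel_measurable M" if "1 \<le> k" for k
    using distributed_measurable[OF laplace, of k] that by simp
  define g where "g n \<omega> = ennreal (real n powr (-7/2)) * ennreal ((\<Sum>k=1..n. X k \<omega>) ^ 4)" for n \<omega>
  have [measurable]: "g n \<in> borel_measurable M" for n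
    unfolding g_def by measurable
  have "(\<integral>\<^sup>+\<omega>. g n \<omega> \<partial>M) \<le> ennreal (4096 * real n powr (-3/2))" for n
  proof -
    have "(\<integral>\<^sup>+\<omega>. g n \<omega> \<partial>M) = ennreal (real n powr (-7/2)) * (\<integral>\<^sup>+\<omega>. ennreal ((\<Sum>k=1..n. X k \<omega>) ^ 4) \<partial>M)"
      unfolding g_def by (subst nn_integral_cmult, measurable)
    also have "\<dots> \<le> ennreal (real n powr (-7/2)) * ennreal (4096 * real n ^ 2)"
      by (intro mult_left_mono laplace_sum_fourth_moment indep_vars_subset[OF indep] laplace) auto
    also have "\<dots> = ennreal (4096 * (real n powr (-7/2) * real n powr 2))"
      by (cases "n = 0") (simp_all add: ennreal_mult' mult_ac powr_numeral flip: ennreal_mult')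
    also have "real n powr (-7/2) * real n powr 2 = real n powr (-3/2)"
      by (simp only: powr_add[symmetric]) simp
    finally show ?thesis .
  qed
  hence "(\<Sum>n. \<integral>\<^sup>+\<omega>. g n \<omega> \<partial>M) \<le> (\<Sum>n. ennreal (4096 * real n powr (-3/2)))"
    by (intro suminf_le) auto
  also have "\<dots> < \<infinity>"
  proof -
    have "summable (\<lambda>n. 4096 * real n powr (-3/2))"
      by (intro summable_mult) (simp add: summable_real_powr_iff)
    hence "(\<Sum>n. ennreal (4096 * real n powr (-3/2))) = ennreal (\<Sum>n. 4096 * real n powr (-3/2))"
      by (intro suminf_ennreal2) simp_all
    thus ?thesis by (simp only: infinity_ennreal_def ennreal_less_top)
  qed
  finally have "(\<integral>\<^sup>+\<omega>. (\<Sum>n. g n \<omega>) \<partial>M) \<noteq> \<infinity>"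
    by (simp add: nn_integral_suminf)
  hence "AE \<omega> in M. (\<Sum>n. g n \<omega>) \<noteq> \<infinity>"
    by (intro nn_integral_noteq_infinite) auto
  thus ?thesis
  proof eventually_elim
    case (elim \<omega>)
    then obtain S where S: "S \<ge> 0" "(\<Sum>n. g n \<omega>) = ennreal S"
      by (cases "\<Sum>n. g n \<omega>") auto
    have "\<bar>\<Sum>k=1..n. X k \<omega>\<bar> \<le> (1 + S) * real n powr (7/8)" for n
    proof (cases "n = 0")
      case False
      define T where "T = (\<Sum>k=1..n. X k \<omega>)"
      have "g n \<omega> \<le> ennreal S"
        using sum_le_suminf[of "\<lambda>n. g n \<omega>" "{n}"] by (simp add: S(2) summableI)
      hence "real n powr (-7/2) * T ^ 4 \<le> S"
        unfolding g_def T_def[symmetric] using S(1) by (simp flip: ennreal_mult')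
      hence "T ^ 4 \<le> S * real n powr (7/2)"
        using False by (simp add: powr_minus field_simps)
      also have "\<dots> \<le> (1 + S) ^ 4 * real n powr (7/2)"
      proof (intro mult_right_mono)
        have "S \<le> (1 + S) ^ 1" by simp
        also have "\<dots> \<le> (1 + S) ^ 4" using S(1) by (intro power_increasing) auto
        finally show "S \<le> (1 + S) ^ 4" .
      qed auto
      also have "real n powr (7/2) = (real n powr (7/8)) ^ 4"
        using False by (simp add: powr_power)
      finally have "\<bar>T\<bar> ^ 4 \<le> ((1 + S) * real n powr (7/8)) ^ 4"
        by (simp add: power_mult_distrib)
      thus ?thesis
        unfolding T_def using S(1) by (subst (asm) power_mono_iff) auto
    qed auto
    thus ?case by blast
  qed
qed

text \<open>Summation by parts turns the growth bound on the partial sums \<open>T\<close> into absolute convergence, because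
  \<open>1/k - 1/(k+1) = 1/(k(k+1))\<close> has order \<open>k powr (-2)\<close>. This takes the place of a maximal
  inequality.\<close>

lemma convergent_sum_div_index:
  fixes x :: "nat \<Rightarrow> real"
  assumes growth: "\<And>n. \<bar>\<Sum>k=1..n. x k\<bar> \<le> K * real n powr (7/8)"
  shows "convergent (\<lambda>n. \<Sum>k=1..n. x k / real k)"
proof -
  define T where "T n = (\<Sum>k=1..n. x k)" for n
  have abel: "(\<Sum>k=1..n. x k / real k) = T n / (real n + 1) + (\<Sum>k=1..n. T k / (real k * (real k + 1)))" for n
  proof (induction n)
    case (Suc n)
    have "T (Suc n) / (real n + 2) + T (Suc n) / ((real n + 1) * (real n + 2)) = T (Suc n) / (real n + 1)"
      by (simp add: divide_simps) (simp add: algebra_simps)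
    moreover have "T (Suc n) / (real n + 1) = T n / (real n + 1) + x (Suc n) / (real n + 1)"
      by (simp add: T_def add_divide_distrib)
    ultimately show ?case using Suc by (simp add: add_ac)
  qed (simp add: T_def)
  have "(\<lambda>n. T n / (real n + 1)) \<longlonglongrightarrow> 0"
  proof (rule Lim_null_comparison)
    show "(\<lambda>n. K * real n powr (7/8) / (real n + 1)) \<longlonglongrightarrow> 0"
      by real_asymp
    show "eventually (\<lambda>n. norm (T n / (real n + 1)) \<le> K * real n powr (7/8) / (real n + 1)) sequentially"
      using growth by (intro always_eventually allI) (auto simp: T_def intro!: divide_right_mono)
  qed
  moreover have "summable (\<lambda>k. T k / (real k * (real k + 1)))"
  proof (rule summable_comparison_test')
    show "summable (\<lambda>k. \<bar>K\<bar> * real k powr (-9/8))"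
      by (intro summable_mult) (simp add: summable_real_powr_iff)
    show "norm (T k / (real k * (real k + 1))) \<le> \<bar>K\<bar> * real k powr (-9/8)" if "k \<ge> 1" for k
    proof -
      have "norm (T k / (real k * (real k + 1))) \<le> norm (T k) / (real k * real k)"
        unfolding norm_divide using that by (intro divide_left_mono) auto
      also have "\<dots> \<le> (\<bar>K\<bar> * real k powr (7/8)) / (real k * real k)"
        using order_trans[OF growth[of k] mult_right_mono[of K "\<bar>K\<bar>"]]
        by (intro divide_right_mono) (auto simp: T_def)
      also have "real k * real k = real k powr 2"
        using that by (simp add: powr_numeral power2_eq_square)
      also have "\<bar>K\<bar> * real k powr (7/8) / real k powr 2 = \<bar>K\<bar> * real k powr (-9/8)"
        by (simp only: times_divide_eq_right[symmetric] powr_diff[symmetric]) simp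
      finally show ?thesis .
    qed
  qed
  hence "convergent (\<lambda>n. \<Sum>k\<le>n. T k / (real k * (real k + 1)))"
    by (simp add: summable_iff_convergent')
  hence "convergent (\<lambda>n. \<Sum>k=1..n. T k / (real k * (real k + 1)))"
  proof (rule back_subst[of convergent])
    show "(\<lambda>n. \<Sum>k\<le>n. T k / (real k * (real k + 1))) = (\<lambda>n. \<Sum>k=1..n. T k / (real k * (real k + 1)))"
      by (intro ext sum.mono_neutral_right) auto
  qed
  ultimately show ?thesis
    unfolding abel by (intro convergent_add) (auto simp: convergent_def)
qed

lemma (in prob_space) AE_convergent_laplace_partial_sum:
  assumes indep: "indep_vars (\<lambda>_. borel) X {1..}"
    and laplace: "\<And>k. k \<ge> 1 \<Longrightarrow> distributed M lborel (X k) (\<lambda>x. ennreal (laplace_density x))"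
  shows "AE \<omega> in M. convergent (\<lambda>n. laplace_partial_sum X n \<omega>)"
proof -
  have "AE \<omega> in M. \<exists>K. \<forall>n. \<bar>\<Sum>k=1..n. X k \<omega>\<bar> \<le> K * real n powr (7/8)"
    by (rule laplace_sum_growth[OF indep laplace])
  thus ?thesis
  proof eventually_elim
    case (elim \<omega>)
    then obtain K where "\<And>n. \<bar>\<Sum>k=1..n. X k \<omega>\<bar> \<le> K * real n powr (7/8)" by blast
    hence "convergent (\<lambda>n. \<Sum>k=1..n. X k \<omega> / real k)"
      by (rule convergent_sum_div_index)
    hence "convergent (\<lambda>n. 1 / (2 * pi) * (\<Sum>k=1..n. X k \<omega> / real k))"
      by (intro convergent_mult convergent_const)
    also have "(\<lambda>n. 1 / (2 * pi) * (\<Sum>k=1..n. X k \<omega> / real k)) = (\<lambda>n. laplace_partial_sum X n \<omega>)"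
      by (simp add: laplace_partial_sum_def sum_distrib_left)
    finally show ?case .
  qed
qed

section \<open>The logistic law as the law of a logarithm of a ratio of exponentials\<close>

text \<open>For \<open>x > 0\<close> the factor \<open>iexp (s * ln x)\<close> is the complex power of \<open>x\<close> with exponent \<open>\<i> s\<close>, so this is
  Euler's integral for the Gamma function.\<close>

lemma integral_exponential_iexp_ln:
  "(\<integral>x. iexp (s * ln x) \<partial>density lborel (exponential_density 1)) = Gamma (1 + \<i> * of_real s)"
proof -
  define g where "g = (\<lambda>x. exponential_density 1 x *\<^sub>R iexp (s * ln x))"
  have "integrable lborel (\<lambda>x. exponential_density 1 x)"
  proof (rule integrableI_nonneg)
    show "(\<integral>\<^sup>+x. ennreal (exponential_density 1 x) \<partial>lborel) < \<infinity>"
      using nn_integral_erlang_ith_moment[of 1 0 0] by simp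
  qed (auto simp: exponential_density_nonneg)
  hence "integrable lborel g"
    by (rule Bochner_Integration.integrable_bound) (auto simp: g_def exponential_density_nonneg)
  hence g1: "(g has_integral integral\<^sup>L lborel g) UNIV"
    by (rule has_integral_integral_lborel)
  have "((\<lambda>x. of_real x powr (1 + \<i> * of_real s - 1) / of_real (exp x)) has_integral Gamma (1 + \<i> * of_real s)) {0<..}"
    by (rule Gamma_integral_complex') simp
  hence "((\<lambda>x. if x \<in> {0<..} then of_real x powr (1 + \<i> * of_real s - 1) / of_real (exp x) else 0)
      has_integral Gamma (1 + \<i> * of_real s)) UNIV"
    by (simp only: has_integral_restrict_UNIV)
  hence g2: "(g has_integral Gamma (1 + \<i> * of_real s)) UNIV"
  proof (rule has_integral_spike[of "{0}", rotated 2])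
    fix x :: real assume "x \<in> UNIV - {0}"
    thus "g x = (if x \<in> {0<..} then of_real x powr (1 + \<i> * of_real s - 1) / of_real (exp x) else 0)"
      by (auto simp: g_def exponential_density_def powr_def Ln_of_real scaleR_conv_of_real exp_minus
          field_simps exp_of_real)
  qed auto
  have "(\<integral>x. iexp (s * ln x) \<partial>density lborel (exponential_density 1)) = integral\<^sup>L lborel g"
    unfolding g_def by (rule integral_density) (auto simp: exponential_density_nonneg)
  also have "\<dots> = Gamma (1 + \<i> * of_real s)"
    by (rule has_integral_unique[OF g1 g2])
  finally show ?thesis .
qed

text \<open>Euler's product for the sine at the imaginary point \<open>z = \<i> y\<close>, combined with the reflection
  formula \<open>Gamma (1 + z) * Gamma (1 - z) = pi z / sin (pi z)\<close>.\<close>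

lemma sin_product_limit_Gamma:
  fixes y :: real
  shows "(\<lambda>n. \<Prod>k=1..n. 1 / (1 + of_real (y / real k) ^ 2))
    \<longlonglongrightarrow> Gamma (1 + \<i> * of_real y) * Gamma (1 - \<i> * complex_of_real y)"
proof (cases "y = 0")
  case False
  define z where "z = \<i> * complex_of_real y"
  have z: "z \<notin> \<int>\<^sub>\<le>\<^sub>0" "1 - z \<notin> \<int>\<^sub>\<le>\<^sub>0" "z \<noteq> 0"
    using False by (auto simp: z_def complex_eq_iff elim!: nonpos_Ints_cases')
  have refl: "Gamma z * Gamma (1 - z) = of_real pi / sin (of_real pi * z)"
    by (rule Gamma_reflection_complex)
  have "Gamma z * Gamma (1 - z) \<noteq> 0"
    using z by (simp add: Gamma_eq_zero_iff)
  hence sin: "sin (of_real pi * z) \<noteq> 0"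
    unfolding refl by auto
  have "(\<lambda>n. of_real pi * z / (of_real pi * z * (\<Prod>k=1..n. 1 - z^2 / of_nat k^2)))
    \<longlonglongrightarrow> of_real pi * z / sin (of_real pi * z)"
    by (intro tendsto_intros sin_product_formula_complex sin)
  also have "(\<lambda>n. of_real pi * z / (of_real pi * z * (\<Prod>k=1..n. 1 - z^2 / of_nat k^2)))
    = (\<lambda>n. \<Prod>k=1..n. 1 / (1 + of_real (y / real k) ^ 2))"
    using z by (simp add: prod_dividef z_def power_mult_distrib power_divide)
  also have "of_real pi * z / sin (of_real pi * z) = z * (Gamma z * Gamma (1 - z))"
    by (simp add: refl)
  also have "\<dots> = Gamma (1 + z) * Gamma (1 - z)"
    using Gamma_plus1[OF z(1)] by (simp add: add.commute)
  finally show ?thesis by (simp add: z_def)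
qed simp

text \<open>The law of \<open>(ln E\<^sub>1 - ln E\<^sub>2) / (2 pi)\<close> for independent standard exponential \<open>E\<^sub>1\<close>, \<open>E\<^sub>2\<close>. It is the
  logistic law, in a form whose characteristic function factorises.\<close>

definition log_ratio_distr :: "real measure" where
  "log_ratio_distr = distr (density lborel (exponential_density 1) \<Otimes>\<^sub>M density lborel (exponential_density 1)) borel
     (\<lambda>(x, y). (ln x - ln y) / (2 * pi))"

lemma real_distribution_log_ratio: "real_distribution log_ratio_distr"
proof -
  interpret E: prob_space "density lborel (exponential_density 1)"
    by (rule prob_space_exponential_density) simp
  interpret P: pair_prob_space "density lborel (exponential_density 1)" "density lborel (exponential_density 1)" ..
  show ?thesis
    unfolding log_ratio_distr_def by (intro P.real_distribution_distr) measurable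
qed

lemma char_log_ratio:
  "char log_ratio_distr t = Gamma (1 + \<i> * of_real (t / (2 * pi))) * Gamma (1 - \<i> * complex_of_real (t / (2 * pi)))"
proof -
  define s where "s = t / (2 * pi)"
  let ?E = "density lborel (exponential_density 1)"
  interpret E: prob_space ?E
    by (rule prob_space_exponential_density) simp
  interpret P: pair_prob_space ?E ?E ..
  have *: "iexp (t * (case p of (x, y) \<Rightarrow> (ln x - ln y) / (2 * pi)))
      = iexp (s * ln (fst p)) * iexp (- s * ln (snd p))" for p
    by (auto simp: s_def case_prod_unfold field_simps simp flip: exp_add)
  have "char log_ratio_distr t = (\<integral>p. iexp (s * ln (fst p)) * iexp (- s * ln (snd p)) \<partial>(?E \<Otimes>\<^sub>M ?E))"
    unfolding char_def log_ratio_distr_def by (subst integral_distr) (simp_all only: *, measurable)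
  also have "\<dots> = (\<integral>x. \<integral>y. iexp (s * ln x) * iexp (- s * ln y) \<partial>?E \<partial>?E)"
    by (subst P.integral_fst'[symmetric])
       (auto intro!: P.P.integrable_const_bound[where B=1] simp: norm_mult)
  also have "\<dots> = (\<integral>x. iexp (s * ln x) \<partial>?E) * (\<integral>y. iexp (- s * ln y) \<partial>?E)"
    by simp
  also have "\<dots> = Gamma (1 + \<i> * of_real s) * Gamma (1 + \<i> * of_real (- s))"
    by (simp only: integral_exponential_iexp_ln)
  finally show ?thesis by (simp add: s_def)
qed

lemma nn_integral_exponential_exp:
  assumes "d > 0"
  shows "(\<integral>\<^sup>+x. ennreal (exp (- x * d)) \<partial>density lborel (exponential_density 1)) = ennreal (1 / (1 + d))"
proof -
  have "(\<integral>\<^sup>+x. ennreal (exp (- x * d)) \<partial>density lborel (exponential_density 1))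
     = (\<integral>\<^sup>+x. ennreal (exponential_density 1 x) * ennreal (exp (- x * d)) \<partial>lborel)"
    by (rule nn_integral_density) auto
  also have "\<dots> = (\<integral>\<^sup>+x. ennreal (1 / (1 + d)) * ennreal (exponential_density (1 + d) x) \<partial>lborel)"
  proof (rule nn_integral_cong)
    fix x :: real
    have "exp (- x) * exp (- x * d) = exp (- x * (1 + d))"
      by (simp add: algebra_simps flip: exp_add)
    hence "exponential_density 1 x * exp (- x * d) = 1 / (1 + d) * exponential_density (1 + d) x"
      using assms by (simp add: exponential_density_def)
    thus "ennreal (exponential_density 1 x) * ennreal (exp (- x * d))
        = ennreal (1 / (1 + d)) * ennreal (exponential_density (1 + d) x)"
      using assms by (simp add: exponential_density_nonneg flip: ennreal_mult)
  qed
  also have "\<dots> = ennreal (1 / (1 + d)) * (\<integral>\<^sup>+x. ennreal (exponential_density (1 + d) x) \<partial>lborel)"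
    by (rule nn_integral_cmult) auto
  also have "\<dots> = ennreal (1 / (1 + d))"
    using nn_integral_erlang_ith_moment[of "1 + d" 0 0] assms by simp
  finally show ?thesis .
qed

text \<open>For a fixed first exponential \<open>x\<close>, the event says that the second one exceeds \<open>x d\<close> with
  \<open>d = exp (- 2 pi a)\<close>, which has probability \<open>exp (- x d)\<close>; integrating over \<open>x\<close> gives \<open>1 / (1 + d)\<close>.\<close>

lemma emeasure_log_ratio_atMost:
  "emeasure log_ratio_distr {..a} = ennreal (1 / (1 + exp (- (2 * pi * a))))"
proof -
  let ?E = "density lborel (exponential_density 1)"
  interpret E: prob_space ?E
    by (rule prob_space_exponential_density) simp
  interpret P: pair_prob_space ?E ?E ..
  define d where "d = exp (- (2 * pi * a))"
  have d: "d > 0" by (simp add: d_def)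
  have E_pos: "AE x in ?E. x > 0"
    by (subst AE_density, simp)
       (use AE_lborel_singleton[of 0] in \<open>auto simp: exponential_density_def elim!: eventually_mono\<close>)
  have E_ne: "AE x in ?E. x \<noteq> b" for b
    by (subst AE_density, simp) (use AE_lborel_singleton[of b] in \<open>auto elim!: eventually_mono\<close>)
  have tail: "emeasure ?E {y. b < y} = ennreal (exp (- b))" if "b \<ge> 0" for b
  proof -
    have "distributed ?E lborel (\<lambda>x. x) (exponential_density 1)"
      unfolding distributed_def
      by (auto intro!: measure_eqI simp: emeasure_distr)
    from E.exponential_distributedD_gt[OF this that] show ?thesis
      by (simp add: E.emeasure_eq_measure)
  qed
  define A where "A = {p :: real \<times> real. (ln (fst p) - ln (snd p)) / (2 * pi) \<le> a}"
  have A: "A \<in> sets (?E \<Otimes>\<^sub>M ?E)"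
  proof -
    have "{p \<in> space (borel \<Otimes>\<^sub>M borel). (ln (fst p) - ln (snd p)) / (2 * pi) \<le> a} \<in> sets (borel \<Otimes>\<^sub>M (borel :: real measure))"
      by measurable
    thus ?thesis
      by (simp add: A_def space_pair_measure cong: sets_pair_measure_cong)
  qed
  have "emeasure log_ratio_distr {..a} = emeasure (?E \<Otimes>\<^sub>M ?E) A"
    unfolding log_ratio_distr_def
    by (subst emeasure_distr) (auto simp: A_def space_pair_measure case_prod_unfold vimage_def)
  also have "\<dots> = (\<integral>\<^sup>+x. emeasure ?E (Pair x -` A) \<partial>?E)"
    by (rule E.emeasure_pair_measure_alt[OF A])
  also have "\<dots> = (\<integral>\<^sup>+x. ennreal (exp (- x * d)) \<partial>?E)"
  proof (rule nn_integral_cong_AE)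
    show "AE x in ?E. emeasure ?E (Pair x -` A) = ennreal (exp (- x * d))"
      using E_pos
    proof eventually_elim
      case (elim x)
      have iff: "(ln x - ln y) / (2 * pi) \<le> a \<longleftrightarrow> x * d \<le> y" if "y > 0" for y
      proof -
        have "(ln x - ln y) / (2 * pi) \<le> a \<longleftrightarrow> ln x - (2 * pi * a) \<le> ln y"
          by (simp add: field_simps)
        also have "ln x - (2 * pi * a) = ln (x * d)"
          using elim d by (simp add: ln_mult d_def)
        also have "\<dots> \<le> ln y \<longleftrightarrow> x * d \<le> y"
          using elim d that by simp
        finally show ?thesis .
      qed
      have "emeasure ?E (Pair x -` A) = emeasure ?E {y. x * d < y}"
      proof (rule emeasure_eq_AE)
        show "AE y in ?E. y \<in> Pair x -` A \<longleftrightarrow> y \<in> {y. x * d < y}"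
          using E_pos E_ne[of "x * d"]
          by eventually_elim (auto simp: A_def iff)
        show "Pair x -` A \<in> sets ?E"
          using sets_Pair1[OF A] by simp
      qed auto
      also have "\<dots> = ennreal (exp (- x * d))"
        using tail[of "x * d"] elim d by simp
      finally show ?case .
    qed
  qed
  also have "\<dots> = ennreal (1 / (1 + d))"
    by (rule nn_integral_exponential_exp[OF d])
  finally show ?thesis by (simp add: d_def)
qed

lemma logistic_density_eq_sech:
  "logistic_density 0 (1 / (2 * pi)) x = pi / 2 * (sech (pi * x))\<^sup>2"
proof -
  define u where "u = exp (pi * x)"
  have u: "u > 0" by (simp add: u_def)
  have e: "exp (- (x - 0) / (1 / (2 * pi))) = 1 / u\<^sup>2"
    by (simp add: u_def power2_eq_square exp_minus field_simps flip: exp_add)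
  have c: "cosh (pi * x) = (u + 1 / u) / 2"
    by (simp add: cosh_def u_def exp_minus field_simps)
  have p: "u + 1 / u > 0" "1 + 1 / u\<^sup>2 > 0" "1 + u\<^sup>2 > 0" using u by (auto intro: add_pos_pos)
  have s: "u + 1 / u = u * (1 + 1 / u\<^sup>2)"
    using u by (simp add: field_simps power2_eq_square)
  show ?thesis
    unfolding logistic_density_def sech_def e c unfolding s
    using u p by (simp add: power_divide power_mult_distrib field_simps) (simp add: power2_eq_square algebra_simps)
qed

text \<open>The antiderivative is the logistic distribution function; the reflection \<open>x \<mapsto> - x\<close> moves the
  half-line to one that is unbounded above, where the fundamental theorem of calculus applies.\<close>

lemma nn_integral_logistic_density:
  "(\<integral>\<^sup>+x. ennreal (logistic_density 0 (1 / (2 * pi)) x) * indicator {..a} x \<partial>lborel)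
    = ennreal (1 / (1 + exp (- (2 * pi * a))))"
proof -
  let ?f = "logistic_density 0 (1 / (2 * pi))"
  have [measurable]: "?f \<in> borel_measurable borel"
    unfolding logistic_density_def by measurable
  have "(\<integral>\<^sup>+x. ennreal (?f x) * indicator {..a} x \<partial>lborel)
      = ennreal \<bar>-1\<bar> * (\<integral>\<^sup>+x. ennreal (?f (0 + (-1) * x)) * indicator {..a} (0 + (-1) * x) \<partial>lborel)"
    by (rule nn_integral_real_affine) auto
  also have "\<dots> = (\<integral>\<^sup>+x. ennreal (?f (- x)) * indicator {- a..} x \<partial>lborel)"
    by (simp, intro nn_integral_cong) (auto simp: indicator_def)
  also have "\<dots> = ennreal (0 - (- (1 / (1 + exp (2 * pi * (- a))))))"
  proof (rule nn_integral_FTC_atLeast)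
    show "((\<lambda>x. - (1 / (1 + exp (2 * pi * x)))) has_real_derivative ?f (- x)) (at x)" for x
    proof -
      have "1 + exp (2 * pi * x) \<noteq> 0" using exp_gt_zero[of "2 * pi * x"] by linarith
      thus ?thesis
        by (auto intro!: derivative_eq_intros simp: logistic_density_def power2_eq_square field_simps)
    qed
    show "((\<lambda>x. - (1 / (1 + exp (2 * pi * x)))) \<longlongrightarrow> 0) at_top"
      by real_asymp
  qed (auto simp: logistic_density_def)
  finally show ?thesis by simp
qed

section \<open>The law of the series\<close>

lemma (in prob_space) char_laplace_partial_sum:
  assumes indep: "indep_vars (\<lambda>_. borel) X {1..}"
    and laplace: "\<And>k. k \<ge> 1 \<Longrightarrow> distributed M lborel (X k) (\<lambda>x. ennreal (laplace_density x))"
  shows "char (distr M borel (laplace_partial_sum X n)) t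
    = (\<Prod>k=1..n. 1 / (1 + of_real (t / (2 * pi) / real k) ^ 2))"
proof -
  have scaled: "char (distr M borel (\<lambda>\<omega>. X k \<omega> / (2 * pi * real k))) t
      = 1 / (1 + of_real (t / (2 * pi) / real k) ^ 2)" if "k \<ge> 1" for k
  proof -
    have [measurable]: "X k \<in> borel_measurable M"
      using distributed_measurable[OF laplace[OF that]] by simp
    have "char (distr M borel (\<lambda>\<omega>. X k \<omega> / (2 * pi * real k))) t
        = char (distr M borel (X k)) (t / (2 * pi) / real k)"
      by (simp add: char_def integral_distr field_simps)
    thus ?thesis by (simp only: char_laplace[OF laplace[OF that]])
  qed
  have "indep_vars (\<lambda>_. borel) X {1..n}"
    by (rule indep_vars_subset[OF indep]) auto
  hence indep': "indep_vars (\<lambda>_. borel) (\<lambda>k \<omega>. X k \<omega> / (2 * pi * real k)) {1..n}"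
    by (rule indep_vars_compose2[where Y = "\<lambda>k x. x / (2 * pi * real k)"]) auto
  have "char (distr M borel (laplace_partial_sum X n)) t
      = (\<Prod>k=1..n. char (distr M borel (\<lambda>\<omega>. X k \<omega> / (2 * pi * real k))) t)"
    unfolding char_distr_sum[OF indep', symmetric]
    by (simp add: laplace_partial_sum_def[abs_def])
  also have "\<dots> = (\<Prod>k=1..n. 1 / (1 + of_real (t / (2 * pi) / real k) ^ 2))"
    by (intro prod.cong refl scaled) auto
  finally show ?thesis .
qed

lemma (in prob_space) char_distr_AE_limit:
  fixes S :: "nat \<Rightarrow> 'a \<Rightarrow> real"
  assumes [measurable]: "\<And>n. S n \<in> borel_measurable M" "L \<in> borel_measurable M"
    and lim: "AE \<omega> in M. (\<lambda>n. S n \<omega>) \<longlonglongrightarrow> L \<omega>"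
  shows "(\<lambda>n. char (distr M borel (S n)) t) \<longlonglongrightarrow> char (distr M borel L) t"
proof -
  have "(\<lambda>n. \<integral>\<omega>. iexp (t * S n \<omega>) \<partial>M) \<longlonglongrightarrow> (\<integral>\<omega>. iexp (t * L \<omega>) \<partial>M)"
  proof (rule integral_dominated_convergence[where w="\<lambda>_. 1"])
    show "AE \<omega> in M. (\<lambda>n. iexp (t * S n \<omega>)) \<longlonglongrightarrow> iexp (t * L \<omega>)"
      using lim by eventually_elim (intro tendsto_intros)
  qed auto
  thus ?thesis by (simp add: char_def integral_distr)
qed

text \<open>Both characteristic functions are the same Gamma product, one by Euler's product and one by Euler's
  integral.\<close>

lemma (in prob_space) distr_laplace_series:
  assumes indep: "indep_vars (\<lambda>_. borel) X {1..}"
    and laplace: "\<And>k. k \<ge> 1 \<Longrightarrow> distributed M lborel (X k) (\<lambda>x. ennreal (laplace_density x))"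
    and L: "is_laplace_series M X L"
  shows "distr M borel L = log_ratio_distr"
proof (rule Levy_uniqueness)
  have [measurable]: "X k \<in> borel_measurable M" if "1 \<le> k" for k
    using distributed_measurable[OF laplace, of k] that by simp
  have S [measurable]: "laplace_partial_sum X n \<in> borel_measurable M" for n
    unfolding laplace_partial_sum_def[abs_def] by measurable
  have meas [measurable]: "L \<in> borel_measurable M"
    and lim: "AE \<omega> in M. (\<lambda>n. laplace_partial_sum X n \<omega>) \<longlonglongrightarrow> L \<omega>"
    using L by (auto simp: is_laplace_series_def)
  show "real_distribution (distr M borel L)"
    by (rule real_distribution_distr[OF meas])
  show "real_distribution log_ratio_distr"
    by (rule real_distribution_log_ratio)
  show "char (distr M borel L) = char log_ratio_distr"
  proof
    fix t
    have "(\<lambda>n. char (distr M borel (laplace_partial_sum X n)) t) \<longlonglongrightarrow> char (distr M borel L) t"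
      by (rule char_distr_AE_limit[OF S meas lim])
    moreover have "(\<lambda>n. char (distr M borel (laplace_partial_sum X n)) t) \<longlonglongrightarrow> char log_ratio_distr t"
    proof -
      have "char (distr M borel (laplace_partial_sum X n)) t
          = (\<Prod>k=1..n. 1 / (1 + of_real (t / (2 * pi) / real k) ^ 2))" for n
        by (rule char_laplace_partial_sum[OF indep laplace])
      thus ?thesis
        using sin_product_limit_Gamma[of "t / (2 * pi)"] by (simp only: char_log_ratio)
    qed
    ultimately show "char (distr M borel L) t = char log_ratio_distr t"
      by (rule LIMSEQ_unique)
  qed
qed

lemma (in prob_space) is_laplace_series_lim:
  assumes indep: "indep_vars (\<lambda>_. borel) X {1..}"
    and laplace: "\<And>k. k \<ge> 1 \<Longrightarrow> distributed M lborel (X k) (\<lambda>x. ennreal (laplace_density x))"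
  shows "is_laplace_series M X (\<lambda>\<omega>. lim (\<lambda>n. laplace_partial_sum X n \<omega>))"
  unfolding is_laplace_series_def
proof
  have [measurable]: "X k \<in> borel_measurable M" if "1 \<le> k" for k
    using distributed_measurable[OF laplace, of k] that by simp
  have [measurable]: "laplace_partial_sum X n \<in> borel_measurable M" for n
    unfolding laplace_partial_sum_def[abs_def] by measurable
  show "(\<lambda>\<omega>. lim (\<lambda>n. laplace_partial_sum X n \<omega>)) \<in> borel_measurable M"
    by measurable
  have "AE \<omega> in M. convergent (\<lambda>n. laplace_partial_sum X n \<omega>)"
    by (rule AE_convergent_laplace_partial_sum[OF indep laplace])
  thus "AE \<omega> in M. (\<lambda>n. laplace_partial_sum X n \<omega>) \<longlonglongrightarrow> lim (\<lambda>n. laplace_partial_sum X n \<omega>)"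
    by eventually_elim (simp add: convergent_LIMSEQ_iff)
qed

lemma (in prob_space) distributed_laplace_series:
  assumes indep: "indep_vars (\<lambda>_. borel) X {1..}"
    and laplace: "\<And>k. k \<ge> 1 \<Longrightarrow> distributed M lborel (X k) (\<lambda>x. ennreal (laplace_density x))"
    and L: "is_laplace_series M X L"
  shows "distributed M lborel L (\<lambda>x. ennreal (logistic_density 0 (1 / (2 * pi)) x))"
proof (rule distributedI_borel_atMost)
  show L_meas: "L \<in> borel_measurable M"
    using L by (simp add: is_laplace_series_def)
  show "logistic_density 0 (1 / (2 * pi)) \<in> borel_measurable borel"
    unfolding logistic_density_def by measurable
  show "AE x in lborel. 0 \<le> logistic_density 0 (1 / (2 * pi)) x"
    by (simp add: logistic_density_def)
  show "(\<integral>\<^sup>+x. ennreal (logistic_density 0 (1 / (2 * pi)) x * indicator {..a} x) \<partial>lborel)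
      = ennreal (1 / (1 + exp (- (2 * pi * a))))" for a
  proof -
    have "ennreal (logistic_density 0 (1 / (2 * pi)) x * indicator {..a} x)
        = ennreal (logistic_density 0 (1 / (2 * pi)) x) * indicator {..a} x" for x
      by (simp add: indicator_def)
    thus ?thesis
      by (simp only: nn_integral_logistic_density)
  qed
  show "emeasure M {\<omega> \<in> space M. L \<omega> \<le> a} = ennreal (1 / (1 + exp (- (2 * pi * a))))" for a
  proof -
    have "emeasure M {\<omega> \<in> space M. L \<omega> \<le> a} = emeasure (distr M borel L) {..a}"
      using L_meas by (subst emeasure_distr) (auto intro!: arg_cong[where f="emeasure M"])
    thus ?thesis
      by (simp only: distr_laplace_series[OF assms] emeasure_log_ratio_atMost)
  qed
qed

theorem mainTheorem1:
  fixes M :: "'a measure" and X :: "nat \<Rightarrow> 'a \<Rightarrow> real"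
  assumes "prob_space M"
    and "prob_space.indep_vars M (\<lambda>_. borel) X {1..}"
    and "\<And>k. k \<ge> 1 \<Longrightarrow> distributed M lborel (X k) (\<lambda>x. ennreal (laplace_density x))"
  shows "(\<exists>L. is_laplace_series M X L) \<and>
    (\<forall>L. is_laplace_series M X L \<longrightarrow>
      (\<exists>m s. s > 0 \<and> distributed M lborel L (\<lambda>x. ennreal (logistic_density m s x))) \<and>
      distributed M lborel L (\<lambda>x. ennreal (pi / 2 * (sech (pi * x))\<^sup>2)))"
proof (intro conjI allI impI)
  interpret prob_space M by fact
  show "\<exists>L. is_laplace_series M X L"
    using is_laplace_series_lim[OF assms(2,3)] by blast
  fix L assume L: "is_laplace_series M X L"
  have logistic: "distributed M lborel L (\<lambda>x. ennreal (logistic_density 0 (1 / (2 * pi)) x))"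
    by (rule distributed_laplace_series[OF assms(2) _ L]) (rule assms(3))
  show "\<exists>m s. s > 0 \<and> distributed M lborel L (\<lambda>x. ennreal (logistic_density m s x))"
    by (rule exI[of _ 0], rule exI[of _ "1 / (2 * pi)"]) (simp only: logistic, simp)
  show "distributed M lborel L (\<lambda>x. ennreal (pi / 2 * (sech (pi * x))\<^sup>2))"
    using logistic by (simp only: logistic_density_eq_sech)
qed

end
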